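(* Let $G$ be a graph on $n$ vertices with vertex $x$, and let $\mathbf{u}^{(1)},\dots,\mathbf{u}^{(k)}\in\mathbb{C}^{2n}$ be a Jordan chain of $K(G)$ for the eigenvalue $\lambda\neq 0$. For a graph $H$ with vertex $y$, let $G\,{}_x\!\circ_y H$ be the graph where $G$ and $H$ have been glued at $x$ and $y$, respectively. If $\mathbf{u}^{(i)}_x=0$ for all $i$, then $G\,{}_x\!\circ_y H$ has a Jordan chain of length $k$ for the eigenvalue $\lambda$ for the matrix $K(G\,{}_x\!\circ_y H)$.
   Context: All graphs are finite, simple and connected. For a graph $G$ on vertices $1,\dots,n$ with adjacency matrix $A$ and diagonal degree matrix $D$, $K(G)$ is the $2n\times 2n$ matrix $K(G)=\begin{bmatrix} A & D-I_n\\ -I_n & 0\end{bmatrix}$. For $\mathbf{u}\in\mathbb{C}^{2n}$ and a vertex $x$, $\mathbf{u}_x$ denotes the entry of $\mathbf{u}$ indexed by $x$ among the first $n$ coordinates. Jordan chain: let $(\lambda,\mathbf{u}^{(1)})$ be an eigenpair for a matrix $N$, let $\mathbf{u}^{(0)}$ be the zero vector, and let $k$ be the largest integer such that the system $(N-\lambda I)\mathbf{u}^{(j+1)}=\mathbf{u}^{(j)}$ has a solution for all $j\in\{0,1,\dots,k-1\}$. The sequence of vectors $\mathbf{u}^{(1)},\dots,\mathbf{u}^{(k)}$ is a Jordan chain of length $k$ of $N$ for the eigenvalue $\lambda$. (Thus $N$ has a Jordan chain of length $k$ for $\lambda$ if and only if the Jordan canonical form of $N$ contains a Jordan block of size $k$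 for $\lambda$.) Gluing: given vertex-disjoint graphs $G\ni x$ and $H\ni y$, the graph $G\,{}_x\!\circ_y H$ is obtained from the disjoint union by identifying $x$ and $y$; that is, its vertex set is $V(G)\cup (V(H)\setminus\{y\})$ and its edge set is $E(G)\cup\{e\in E(H): y\notin e\}\cup\{vx: vy\in E(H)\}$.
   Formalization: Jordan chains being maximal by definition, the claim with length exactly k is false: the extended chain may become extendable in the glued graph. The formal theorem concludes that K of the glued graph has a Jordan chain of some length k' ≥ k for λ. *)

theory Defs
  imports Complex_Main "Jordan_Normal_Form.Char_Poly"
begin

record 'a graph =
  verts :: "'a set"
  edges :: "'a set set"

definition simple_graph :: "'a graph \<Rightarrow> bool" where
  "simple_graph G \<longleftrightarrow> finite (verts G) \<and> (\<forall>e\<in>edges G. e \<subseteq> verts G \<and> card e = 2)"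

definition connected_graph :: "'a graph \<Rightarrow> bool" where
  "connected_graph G \<longleftrightarrow>
     (\<forall>v\<in>verts G. \<forall>w\<in>verts G. (v, w) \<in> {(a, b). {a, b} \<in> edges G}\<^sup>*)"

definition vertex_degree :: "'a graph \<Rightarrow> 'a \<Rightarrow> nat" where
  "vertex_degree G v = card {e \<in> edges G. v \<in> e}"

(* G and H are meant to be vertex-disjoint; the identified vertex keeps the name x. *)
definition glue :: "'a graph \<Rightarrow> 'a \<Rightarrow> 'a graph \<Rightarrow> 'a \<Rightarrow> 'a graph" where
  "glue G x H y =
     \<lparr> verts = verts G \<union> (verts H - {y}),
       edges = edges G \<union> {e \<in> edges H. y \<notin> e} \<union> {{v, x} | v. {v, y} \<in> edges H} \<rparr>"

(* The matrices are indexed by positions, so they depend on a numbering of the vertices: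
   the list vs plays the role of the vertex labels 1, ..., n. *)
definition vertex_order :: "'a graph \<Rightarrow> 'a list \<Rightarrow> bool" where
  "vertex_order G vs \<longleftrightarrow> distinct vs \<and> set vs = verts G"

definition adj_mat :: "'a graph \<Rightarrow> 'a list \<Rightarrow> complex mat" where
  "adj_mat G vs =
     mat (length vs) (length vs) (\<lambda>(i, j). if {vs ! i, vs ! j} \<in> edges G then 1 else 0)"

definition deg_mat :: "'a graph \<Rightarrow> 'a list \<Rightarrow> complex mat" where
  "deg_mat G vs =
     mat (length vs) (length vs) (\<lambda>(i, j). if i = j then of_nat (vertex_degree G (vs ! i)) else 0)"

definition K_mat :: "'a graph \<Rightarrow> 'a list \<Rightarrow> complex mat" where
  "K_mat G vs = (let n = length vs in
     four_block_mat (adj_mat G vs) (deg_mat G vs - 1\<^sub>m n) (- 1\<^sub>m n) (0\<^sub>m n n))"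

definition chain_system :: "complex mat \<Rightarrow> complex \<Rightarrow> nat \<Rightarrow> (nat \<Rightarrow> complex vec) \<Rightarrow> bool" where
  "chain_system N l k u \<longleftrightarrow>
     eigenvector N (u 1) l \<and> u 0 = 0\<^sub>v (dim_row N) \<and>
     (\<forall>j<k. u (Suc j) \<in> carrier_vec (dim_row N) \<and>
            (N - l \<cdot>\<^sub>m 1\<^sub>m (dim_row N)) *\<^sub>v u (Suc j) = u j)"

(* The length k is the largest one possible for the given eigenvector u 1, the later vectors being
   free to vary.  Requiring only that the chosen u k has no preimage would be too weak: with
   Jordan blocks of sizes 3 and 1 it would admit a chain of length 2. *)
definition jordan_chain :: "complex mat \<Rightarrow> complex \<Rightarrow> nat \<Rightarrow> (nat \<Rightarrow> complex vec) \<Rightarrow> bool" where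
  "jordan_chain N l k u \<longleftrightarrow>
     chain_system N l k u \<and> (\<forall>k' w. chain_system N l k' w \<and> w 1 = u 1 \<longrightarrow> k' \<le> k)"

end

theory Submission
  imports Defs
begin

text \<open>
  A vector indexed by two copies of the vertex list is a pair \<open>(f, g)\<close> of functions on the
  vertices. In these terms \<open>(K(G) - \<mu>)(f, g) = (f', g')\<close> says that, at every vertex \<open>v\<close>, the
  sum of \<open>f\<close> over the neighbours of \<open>v\<close> plus \<open>(deg v - 1) g(v) - \<mu> f(v)\<close> is \<open>f'(v)\<close>, and
  \<open>- f(v) - \<mu> g(v)\<close> is \<open>g'(v)\<close>.
  Along a Jordan chain whose \<open>f\<close>-parts vanish at \<open>x\<close>, the second equation at \<open>x\<close> reads
  \<open>g\<^sub>j\<^sub>+\<^sub>1(x) = - g\<^sub>j(x) / \<mu>\<close>; because the chain starts from the zero vector and \<open>\<mu> \<noteq> 0\<close>, the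
  \<open>g\<close>-parts vanish at \<open>x\<close> as well (\<open>K_chain_vanishes_second\<close>).

  Extend every vector of the chain by zero to the glued graph. The only vertex of \<open>G\<close> whose degree
  changes is \<open>x\<close>, and there the degree is multiplied by \<open>g(x) = 0\<close>. The only vertex of \<open>G\<close> with
  neighbours in \<open>H\<close> is \<open>x\<close>; it contributes \<open>f(x) = 0\<close> to the equations at those neighbours, and they
  contribute zero to the equation at \<open>x\<close>.
  So the extended vectors satisfy all the equations of the glued graph (\<open>glue_K_step\<close>).

  The extended chain need not be of maximal length for its eigenvector. However, the vectors of a
  chain are linearly independent, so lengths are bounded by the size of the matrix and some chain
  with the same eigenvector is maximal (\<open>jordan_chain_exists\<close>).
\<close>

section \<open>Chains of maximal length\<close>

lemma shifted_mult_vec: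
  fixes N :: "complex mat"
  assumes "N \<in> carrier_mat n n" and "w \<in> carrier_vec n"
  shows "(N - l \<cdot>\<^sub>m 1\<^sub>m n) *\<^sub>v w = N *\<^sub>v w - l \<cdot>\<^sub>v w"
proof -
  have "(l \<cdot>\<^sub>m 1\<^sub>m n) *\<^sub>v w = l \<cdot>\<^sub>v w"
  proof (rule eq_vecI)
    fix i assume "i < dim_vec (l \<cdot>\<^sub>v w)"
    then have i: "i < n" using assms by simp
    have "row (l \<cdot>\<^sub>m 1\<^sub>m n) i = l \<cdot>\<^sub>v unit_vec n i"
      using i by (intro eq_vecI) (auto simp: unit_vec_def)
    then show "((l \<cdot>\<^sub>m 1\<^sub>m n) *\<^sub>v w) $ i = (l \<cdot>\<^sub>v w) $ i"
      using i assms by simp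
  qed (use assms in simp)
  then show ?thesis
    using assms by (subst minus_mult_distrib_mat_vec[of _ n n]) auto
qed

text \<open>
  If there were more than \<open>n\<close> vectors, some nontrivial combination of them would vanish. Applying
  \<open>N - l\<close> moves every vector one place down the chain; repeated until the last vector with a
  nonzero coefficient has reached the bottom, it leaves a nonzero multiple of the eigenvector.
\<close>

lemma chain_system_length_le:
  assumes N: "N \<in> carrier_mat n n" and chain: "chain_system N l m w"
  shows "m \<le> n"
proof (rule ccontr)
  assume "\<not> m \<le> n"
  define T where "T = N - l \<cdot>\<^sub>m 1\<^sub>m n"
  have T: "T \<in> carrier_mat n n" unfolding T_def by (rule minus_carrier_mat) simp
  have w1: "w 1 \<in> carrier_vec n" "w 1 \<noteq> 0\<^sub>v n" and w0: "w 0 = 0\<^sub>v n"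
    and step: "\<And>j. j < m \<Longrightarrow> w (Suc j) \<in> carrier_vec n \<and> T *\<^sub>v w (Suc j) = w j"
    using chain N by (auto simp: chain_system_def eigenvector_def T_def)
  \<comment> \<open>An extra zero row makes the matrix with columns \<open>w 1, ..., w (n + 1)\<close> square and singular.\<close>
  define M where "M = mat\<^sub>r (Suc n) (Suc n)
    (\<lambda>i. if i = n then 0\<^sub>v (Suc n) else vec (Suc n) (\<lambda>j. w (Suc j) $ i))"
  have M: "M \<in> carrier_mat (Suc n) (Suc n)" by (simp add: M_def)
  have "det M = 0" unfolding M_def by (rule det_row_0) auto
  then obtain c where c: "c \<in> carrier_vec (Suc n)" "c \<noteq> 0\<^sub>v (Suc n)" "M *\<^sub>v c = 0\<^sub>v (Suc n)"
    using det_0_iff_vec_prod_zero[OF M] by blast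
  have comb: "(\<Sum>j<Suc n. c $ j * w (Suc j) $ i) = 0" if "i < n" for i
  proof -
    have "(M *\<^sub>v c) $ i = 0" using c that by simp
    then show ?thesis
      using that c M
      by (simp add: M_def scalar_prod_def mult.commute atLeast0LessThan del: sum.lessThan_Suc)
  qed
  define S where "S = {j. j < Suc n \<and> c $ j \<noteq> 0}"
  have "finite S" by (simp add: S_def)
  moreover have "S \<noteq> {}"
    using c(1,2) by (auto simp: S_def vec_eq_iff)
  ultimately have p: "Max S \<in> S" and above: "\<And>j. j \<in> S \<Longrightarrow> j \<le> Max S" by auto
  define p where "p = Max S"
  have p_less: "p < Suc n" and cp: "c $ p \<noteq> 0" using p by (auto simp: p_def S_def)
  \<comment> \<open>Truncated subtraction is right here: below the bottom of the chain lies \<open>w 0 = 0\<close>.\<close>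
  have shifted_comb: "\<forall>i<n. (\<Sum>j<Suc n. c $ j * w (Suc j - r) $ i) = 0" for r
  proof (induction r)
    case 0
    then show ?case using comb by (simp del: sum.lessThan_Suc)
  next
    case (Suc r)
    have down: "w (Suc j - Suc r) $ i = (\<Sum>q<n. T $$ (i, q) * w (Suc j - r) $ q)"
      if "j < Suc n" "i < n" for i j
    proof (cases "Suc j - r")
      case 0
      then show ?thesis using w0 that by simp
    next
      case (Suc t)
      then have "t < m" using that \<open>\<not> m \<le> n\<close> by linarith
      then have *: "w (Suc t) \<in> carrier_vec n" "T *\<^sub>v w (Suc t) = w t" using step by auto
      have "w t $ i = (T *\<^sub>v w (Suc t)) $ i" using * by simp
      also have "\<dots> = (\<Sum>q<n. T $$ (i, q) * w (Suc t) $ q)"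
        using *(1) T that by (simp add: scalar_prod_def atLeast0LessThan)
      finally have "w t $ i = (\<Sum>q<n. T $$ (i, q) * w (Suc t) $ q)" .
      moreover have "Suc j - Suc r = t" using Suc by simp
      ultimately show ?thesis using Suc by simp
    qed
    show ?case
    proof (intro allI impI)
      fix i assume i: "i < n"
      have "(\<Sum>j<Suc n. c $ j * w (Suc j - Suc r) $ i)
          = (\<Sum>j<Suc n. \<Sum>q<n. T $$ (i, q) * (c $ j * w (Suc j - r) $ q))"
        using down i by (intro sum.cong) (auto simp: sum_distrib_left mult_ac)
      also have "\<dots> = (\<Sum>q<n. T $$ (i, q) * (\<Sum>j<Suc n. c $ j * w (Suc j - r) $ q))"
        by (subst sum.swap) (simp add: sum_distrib_left del: sum.lessThan_Suc)
      also have "\<dots> = 0" using Suc.IH by (simp del: sum.lessThan_Suc)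
      finally show "(\<Sum>j<Suc n. c $ j * w (Suc j - Suc r) $ i) = 0" .
    qed
  qed
  have "w 1 $ i = 0" if i: "i < n" for i
  proof -
    have "c $ j * w (Suc j - p) $ i = 0" if "j < Suc n" "j \<noteq> p" for j
    proof (cases "j < p")
      case True
      then show ?thesis using w0 i by simp
    next
      case False
      then have "j \<notin> S" using above[of j] that by (auto simp: p_def)
      then show ?thesis using that by (simp add: S_def)
    qed
    then have "(\<Sum>j<Suc n. c $ j * w (Suc j - p) $ i) = (\<Sum>j\<in>{p}. c $ j * w (Suc j - p) $ i)"
      using p_less by (intro sum.mono_neutral_right) auto
    then have "c $ p * w 1 $ i = 0" using shifted_comb[of p] i by simp
    then show ?thesis using cp by simp
  qed
  then show False using w1 by (auto simp: vec_eq_iff)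
qed

lemma jordan_chain_exists:
  assumes "N \<in> carrier_mat n n" and "chain_system N l k w"
  shows "\<exists>k' v. k \<le> k' \<and> jordan_chain N l k' v"
proof -
  define P where "P m \<longleftrightarrow> (\<exists>v. chain_system N l m v \<and> v 1 = w 1)" for m
  have "P k" using assms by (auto simp: P_def)
  moreover have "m \<le> n" if "P m" for m
    using that chain_system_length_le assms(1) by (auto simp: P_def)
  ultimately obtain k' where k': "P k'" "\<And>m. P m \<Longrightarrow> m \<le> k'"
    using GreatestI_nat[of P k n] Greatest_le_nat[of P _ n] by blast
  then obtain v where "chain_system N l k' v" "v 1 = w 1" by (auto simp: P_def)
  then have "jordan_chain N l k' v"
    using k'(2) by (auto simp: jordan_chain_def P_def)
  then show ?thesis using k'(2)[OF \<open>P k\<close>] by blast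
qed

text \<open>An eigenvector alone is a chain of length one, so a maximal chain is never empty.\<close>

lemma jordan_chain_length_pos:
  assumes "N \<in> carrier_mat n n" and "jordan_chain N l k u"
  shows "0 < k"
proof -
  have "eigenvector N (u 1) l" "u 0 = 0\<^sub>v (dim_row N)"
    using assms(2) by (auto simp: jordan_chain_def chain_system_def)
  then have "chain_system N l 1 u"
    using assms(1) shifted_mult_vec[OF assms(1), of "u 1" l]
    by (auto simp: chain_system_def eigenvector_def)
  then show ?thesis
    using assms(2) by (fastforce simp: jordan_chain_def)
qed

section \<open>The matrix K as an operator on pairs of vertex functions\<close>

definition vertex_vec :: "'a list \<Rightarrow> ('a \<Rightarrow> complex) \<Rightarrow> ('a \<Rightarrow> complex) \<Rightarrow> complex vec" where
  "vertex_vec vs f g =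
     vec (length vs) (\<lambda>i. f (vs ! i)) @\<^sub>v vec (length vs) (\<lambda>i. g (vs ! i))"

definition neighbour_sum :: "'a graph \<Rightarrow> 'a set \<Rightarrow> ('a \<Rightarrow> complex) \<Rightarrow> 'a \<Rightarrow> complex" where
  "neighbour_sum G V f v = (\<Sum>w\<in>V. if {v, w} \<in> edges G then f w else 0)"

text \<open>
  The relation \<open>(K(G) - l)(f, g) = (f', g')\<close>, read vertex by vertex. It does not mention any
  numbering of the vertices, which is what makes chains over different vertex lists comparable.
\<close>

definition K_step :: "'a graph \<Rightarrow> 'a set \<Rightarrow> complex \<Rightarrow>
    ('a \<Rightarrow> complex) \<Rightarrow> ('a \<Rightarrow> complex) \<Rightarrow> ('a \<Rightarrow> complex) \<Rightarrow> ('a \<Rightarrow> complex) \<Rightarrow> bool" where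
  "K_step G V l f g f' g' \<longleftrightarrow> (\<forall>v\<in>V.
     neighbour_sum G V f v + (of_nat (vertex_degree G v) - 1) * g v - l * f v = f' v \<and>
     - f v - l * g v = g' v)"

lemma vertex_vec_carrier [simp]:
  "vertex_vec vs f g \<in> carrier_vec (length vs + length vs)"
  by (simp add: vertex_vec_def)

lemma dim_vertex_vec [simp]: "dim_vec (vertex_vec vs f g) = length vs + length vs"
  by (simp add: vertex_vec_def)

lemma vertex_vec_first:
  "p < length vs \<Longrightarrow> vertex_vec vs f g $ p = f (vs ! p)"
  by (simp add: vertex_vec_def)

lemma vertex_vec_eq_iff:
  "vertex_vec vs f g = vertex_vec vs f' g' \<longleftrightarrow> (\<forall>v\<in>set vs. f v = f' v \<and> g v = g' v)"
  unfolding vertex_vec_def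
  by (subst append_vec_eq[of _ "length vs"]) (auto simp: vec_eq_iff all_set_conv_all_nth)

lemma vertex_vec_zero: "vertex_vec vs (\<lambda>_. 0) (\<lambda>_. 0) = 0\<^sub>v (length vs + length vs)"
  by (rule eq_vecI) (auto simp: vertex_vec_def)

text \<open>
  Fixing the functions to be zero off the vertex list turns the same pair \<open>(f, g)\<close> into the
  extension by zero when it is read over a larger graph.
\<close>

lemma vertex_vec_exhaust:
  assumes "distinct vs" and "u \<in> carrier_vec (length vs + length vs)"
  obtains f g where "u = vertex_vec vs f g" and "\<And>v. v \<notin> set vs \<Longrightarrow> f v = 0 \<and> g v = 0"
proof -
  define pos where "pos = the_inv_into {..<length vs} ((!) vs)"
  have inj: "inj_on ((!) vs) {..<length vs}"
    using assms(1) by (auto simp: inj_on_def nth_eq_iff_index_eq)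
  have pos: "pos (vs ! i) = i" if "i < length vs" for i
    unfolding pos_def using the_inv_into_f_f[OF inj] that by simp
  define f where "f v = (if v \<in> set vs then u $ pos v else 0)" for v
  define g where "g v = (if v \<in> set vs then u $ (length vs + pos v) else 0)" for v
  have "u = vertex_vec vs f g"
    using assms(2) by (intro eq_vecI) (auto simp: vertex_vec_def f_def g_def pos)
  then show ?thesis by (rule that) (simp add: f_def g_def)
qed

lemma K_mat_carrier [simp]: "K_mat G vs \<in> carrier_mat (length vs + length vs) (length vs + length vs)"
  by (simp add: K_mat_def Let_def adj_mat_def)

lemma dim_row_K_mat [simp]: "dim_row (K_mat G vs) = length vs + length vs"
  using K_mat_carrier by blast

lemma adj_mat_mult:
  assumes "distinct vs"
  shows "adj_mat G vs *\<^sub>v vec (length vs) (\<lambda>i. f (vs ! i))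
    = vec (length vs) (\<lambda>i. neighbour_sum G (set vs) f (vs ! i))"
proof (rule eq_vecI)
  fix i assume "i < dim_vec (vec (length vs) (\<lambda>i. neighbour_sum G (set vs) f (vs ! i)))"
  then have i: "i < length vs" by simp
  have "neighbour_sum G (set vs) f (vs ! i)
      = (\<Sum>j<length vs. if {vs ! i, vs ! j} \<in> edges G then f (vs ! j) else 0)"
    unfolding neighbour_sum_def
    by (rule sum.reindex_bij_betw[OF bij_betw_nth[OF assms refl refl], symmetric])
  also have "\<dots> = (adj_mat G vs *\<^sub>v vec (length vs) (\<lambda>i. f (vs ! i))) $ i"
    using i by (auto simp: adj_mat_def scalar_prod_def atLeast0LessThan intro!: sum.cong)
  finally show "(adj_mat G vs *\<^sub>v vec (length vs) (\<lambda>i. f (vs ! i))) $ i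
      = vec (length vs) (\<lambda>i. neighbour_sum G (set vs) f (vs ! i)) $ i"
    using i by simp
qed (simp add: adj_mat_def)

lemma deg_mat_minus_one_mult:
  "(deg_mat G vs - 1\<^sub>m (length vs)) *\<^sub>v vec (length vs) (\<lambda>i. g (vs ! i))
    = vec (length vs) (\<lambda>i. (of_nat (vertex_degree G (vs ! i)) - 1) * g (vs ! i))"
    (is "?L = ?R")
proof (rule eq_vecI)
  fix i assume "i < dim_vec ?R"
  then have i: "i < length vs" by simp
  have "?L $ i = (\<Sum>j<length vs.
      (deg_mat G vs - 1\<^sub>m (length vs)) $$ (i, j) * g (vs ! j))"
    using i by (simp add: scalar_prod_def atLeast0LessThan deg_mat_def)
  also have "\<dots> = (\<Sum>j<length vs.
      if i = j then (of_nat (vertex_degree G (vs ! i)) - 1) * g (vs ! i) else 0)"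
    using i by (intro sum.cong) (auto simp: deg_mat_def)
  also have "\<dots> = ?R $ i" using i by simp
  finally show "?L $ i = ?R $ i" .
qed simp

lemma K_mat_mult:
  assumes "distinct vs"
  shows "K_mat G vs *\<^sub>v vertex_vec vs f g = vertex_vec vs
    (\<lambda>v. neighbour_sum G (set vs) f v + (of_nat (vertex_degree G v) - 1) * g v) (\<lambda>v. - f v)"
proof -
  let ?n = "length vs"
  let ?f = "vec ?n (\<lambda>i. f (vs ! i))" and ?g = "vec ?n (\<lambda>i. g (vs ! i))"
  have "- 1\<^sub>m ?n *\<^sub>v ?f = vec ?n (\<lambda>i. - f (vs ! i))"
    by (rule eq_vecI) auto
  moreover have "0\<^sub>m ?n ?n *\<^sub>v ?g = 0\<^sub>v ?n" by (rule eq_vecI) auto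
  moreover have "K_mat G vs *\<^sub>v vertex_vec vs f g =
      (adj_mat G vs *\<^sub>v ?f + (deg_mat G vs - 1\<^sub>m ?n) *\<^sub>v ?g)
      @\<^sub>v (- 1\<^sub>m ?n *\<^sub>v ?f + 0\<^sub>m ?n ?n *\<^sub>v ?g)"
    unfolding K_mat_def Let_def vertex_vec_def
    by (rule four_block_mat_mult_vec) (auto simp: adj_mat_def deg_mat_def)
  ultimately show ?thesis
    unfolding adj_mat_mult[OF assms] deg_mat_minus_one_mult vertex_vec_def
    by (auto simp: vec_eq_iff)
qed

lemma K_mat_shifted_mult_iff:
  assumes "distinct vs"
  shows "(K_mat G vs - l \<cdot>\<^sub>m 1\<^sub>m (length vs + length vs)) *\<^sub>v vertex_vec vs f g = vertex_vec vs f' g'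
    \<longleftrightarrow> K_step G (set vs) l f g f' g'"
proof -
  have "(K_mat G vs - l \<cdot>\<^sub>m 1\<^sub>m (length vs + length vs)) *\<^sub>v vertex_vec vs f g
      = vertex_vec vs
          (\<lambda>v. neighbour_sum G (set vs) f v + (of_nat (vertex_degree G v) - 1) * g v - l * f v)
          (\<lambda>v. - f v - l * g v)"
    unfolding shifted_mult_vec[OF K_mat_carrier vertex_vec_carrier] K_mat_mult[OF assms]
    by (rule eq_vecI) (auto simp: vertex_vec_def)
  then show ?thesis by (simp add: vertex_vec_eq_iff K_step_def)
qed

text \<open>
  At \<open>x\<close> the second block equation becomes \<open>l * g (Suc j) x = - g j x\<close>, and the chain starts
  with the zero vector.
\<close>

lemma K_chain_vanishes_second:
  assumes "x \<in> V" and "l \<noteq> 0" and "g 0 x = 0"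
    and "\<And>j. j < k \<Longrightarrow> K_step G V l (f (Suc j)) (g (Suc j)) (f j) (g j)"
    and "\<And>j. j \<le> k \<Longrightarrow> f j x = 0"
  shows "j \<le> k \<Longrightarrow> g j x = 0"
proof (induction j)
  case 0
  then show ?case using assms(3) by simp
next
  case (Suc j)
  have "- f (Suc j) x - l * g (Suc j) x = g j x"
    using assms(4)[of j] assms(1) Suc.prems by (auto simp: K_step_def)
  then show ?case using Suc assms(2) assms(5)[of "Suc j"] by simp
qed

section \<open>Extension by zero to a glued graph\<close>

lemma simple_graph_edge_subset:
  "simple_graph G \<Longrightarrow> e \<in> edges G \<Longrightarrow> e \<subseteq> verts G"
  by (auto simp: simple_graph_def)

lemma glue_edge_within_first:
  assumes "simple_graph H" and "verts G \<inter> verts H = {}"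
    and "v \<in> verts G" and "w \<in> verts G"
    and "simple_graph G"
  shows "{v, w} \<in> edges (glue G x H y) \<longleftrightarrow> {v, w} \<in> edges G"
  using assms simple_graph_edge_subset[OF assms(1)]
  by (fastforce simp: glue_def doubleton_eq_iff)

lemma glue_edge_across:
  assumes "simple_graph G" and "simple_graph H" and "verts G \<inter> verts H = {}"
    and "v \<in> verts H" and "w \<in> verts G" and "w \<noteq> x"
  shows "{v, w} \<notin> edges (glue G x H y)"
  using assms simple_graph_edge_subset[OF assms(1)] simple_graph_edge_subset[OF assms(2)]
  by (fastforce simp: glue_def doubleton_eq_iff)

lemma glue_vertex_degree:
  assumes "simple_graph H" and "verts G \<inter> verts H = {}" and "v \<in> verts G" and "v \<noteq> x"
  shows "vertex_degree (glue G x H y) v = vertex_degree G v"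
proof -
  have "{e \<in> edges (glue G x H y). v \<in> e} = {e \<in> edges G. v \<in> e}"
    using assms simple_graph_edge_subset[OF assms(1)] by (fastforce simp: glue_def)
  then show ?thesis by (simp add: vertex_degree_def)
qed

text \<open>
  Gluing changes the degree of \<open>x\<close>, which multiplies \<open>g x = 0\<close>, and adds edges. A new edge that
  meets \<open>G\<close> joins \<open>x\<close> to a vertex of \<open>H\<close>, and \<open>f\<close> vanishes at both ends.
\<close>

lemma glue_K_step:
  assumes G: "simple_graph G" and H: "simple_graph H" and disj: "verts G \<inter> verts H = {}"
    and step: "K_step G (verts G) l f g f' g'"
    and at_x: "f x = 0" "g x = 0"
    and outside: "\<And>v. v \<notin> verts G \<Longrightarrow> f v = 0 \<and> g v = 0 \<and> f' v = 0 \<and> g' v = 0"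
  shows "K_step (glue G x H y) (verts (glue G x H y)) l f g f' g'"
  unfolding K_step_def
proof
  fix v assume v: "v \<in> verts (glue G x H y)"
  let ?G' = "glue G x H y"
  have fin: "finite (verts ?G')" and sub: "verts G \<subseteq> verts ?G'"
    using G H by (auto simp: glue_def simple_graph_def)
  show "neighbour_sum ?G' (verts ?G') f v + (of_nat (vertex_degree ?G' v) - 1) * g v - l * f v
      = f' v \<and> - f v - l * g v = g' v"
  proof (cases "v \<in> verts G")
    case True
    have nbrs: "neighbour_sum ?G' (verts ?G') f v = neighbour_sum G (verts G) f v"
      unfolding neighbour_sum_def
      using fin sub outside glue_edge_within_first[OF H disj True _ G]
      by (intro sum.mono_neutral_cong_right) auto
    have deg: "(of_nat (vertex_degree ?G' v) - 1) * g v
        = (of_nat (vertex_degree G v) - 1) * g v"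
      using glue_vertex_degree[OF H disj True] at_x by (cases "v = x") auto
    show ?thesis unfolding nbrs deg using step True unfolding K_step_def by blast
  next
    case False
    then have "v \<in> verts H" using v by (simp add: glue_def)
    then have "neighbour_sum ?G' (verts ?G') f v = 0"
      unfolding neighbour_sum_def
      using glue_edge_across[OF G H disj] outside at_x
      by (intro sum.neutral) (metis (full_types))
    then show ?thesis using outside[OF False] by simp
  qed
qed

theorem theorem4p1:
  fixes G H :: "'a graph" and x y :: 'a and vs ws :: "'a list"
    and \<mu> :: complex and k :: nat and u :: "nat \<Rightarrow> complex vec"
  assumes "simple_graph G" and "connected_graph G" and "x \<in> verts G"
    and "simple_graph H" and "connected_graph H" and "y \<in> verts H"
    and "verts G \<inter> verts H = {}"
    and "vertex_order G vs" and "vertex_order (glue G x H y) ws"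
    and "\<mu> \<noteq> 0" and "jordan_chain (K_mat G vs) \<mu> k u"
    and "\<forall>i\<in>{1..k}. \<forall>p<length vs. vs ! p = x \<longrightarrow> u i $ p = 0"
  shows "\<exists>k' v. k \<le> k' \<and> jordan_chain (K_mat (glue G x H y) ws) \<mu> k' v"
proof -
  let ?G' = "glue G x H y"
  let ?n = "length vs + length vs" and ?n' = "length ws + length ws"
  have vs: "distinct vs" "set vs = verts G" and ws: "distinct ws" "set ws = verts ?G'"
    using assms(8,9) by (auto simp: vertex_order_def)
  have k: "0 < k" by (rule jordan_chain_length_pos[OF K_mat_carrier assms(11)])
  have u0: "u 0 = 0\<^sub>v ?n" and u1: "u 1 \<noteq> 0\<^sub>v ?n"
    and chain: "\<And>j. j < k \<Longrightarrow> u (Suc j) \<in> carrier_vec ?n \<and>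
      (K_mat G vs - \<mu> \<cdot>\<^sub>m 1\<^sub>m ?n) *\<^sub>v u (Suc j) = u j"
    using assms(11) by (auto simp: jordan_chain_def chain_system_def eigenvector_def)
  have "\<exists>f g. j \<le> k \<longrightarrow> u j = vertex_vec vs f g \<and> (\<forall>v. v \<notin> verts G \<longrightarrow> f v = 0 \<and> g v = 0)" for j
  proof (cases "j \<le> k")
    case True
    then have "u j \<in> carrier_vec ?n" using u0 chain by (cases j) auto
    then show ?thesis using vertex_vec_exhaust[OF vs(1)] vs(2) by metis
  qed simp
  then obtain f g where u: "\<And>j. j \<le> k \<Longrightarrow> u j = vertex_vec vs (f j) (g j)"
    and outside: "\<And>j v. j \<le> k \<Longrightarrow> v \<notin> verts G \<Longrightarrow> f j v = 0 \<and> g j v = 0"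
    by metis
  have zero: "f 0 v = 0" "g 0 v = 0" for v
  proof -
    have "vertex_vec vs (f 0) (g 0) = vertex_vec vs (\<lambda>_. 0) (\<lambda>_. 0)"
      using u[of 0] u0 by (simp add: vertex_vec_zero)
    then show "f 0 v = 0" "g 0 v = 0"
      using outside[of 0 v] vs(2) by (auto simp: vertex_vec_eq_iff)
  qed
  have step: "K_step G (verts G) \<mu> (f (Suc j)) (g (Suc j)) (f j) (g j)" if "j < k" for j
    using chain[OF that] u[of j] u[of "Suc j"] that K_mat_shifted_mult_iff[OF vs(1)] vs(2)
    by (metis less_imp_le_nat Suc_leI)
  have fx: "f j x = 0" if "j \<le> k" for j
  proof (cases "j = 0")
    case False
    obtain p where p: "p < length vs" "vs ! p = x"
      using assms(3) vs(2) by (metis in_set_conv_nth)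
    then have "u j $ p = 0" using assms(12) False that by auto
    then show ?thesis using p u[OF that] by (simp add: vertex_vec_first)
  qed (simp add: zero)
  have gx: "g j x = 0" if "j \<le> k" for j
    by (rule K_chain_vanishes_second[OF assms(3,10) zero(2) step fx that])
  define v where "v j = vertex_vec ws (f j) (g j)" for j
  have v0: "v 0 = 0\<^sub>v ?n'"
    unfolding v_def vertex_vec_zero[symmetric] vertex_vec_eq_iff by (simp add: zero)
  have v_step: "(K_mat ?G' ws - \<mu> \<cdot>\<^sub>m 1\<^sub>m ?n') *\<^sub>v v (Suc j) = v j" if "j < k" for j
    unfolding v_def K_mat_shifted_mult_iff[OF ws(1)] ws(2)
    using that outside[of j] outside[of "Suc j"]
    by (intro glue_K_step[OF assms(1,4,7) step] fx gx) auto
  have "v 1 \<noteq> 0\<^sub>v ?n'"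
  proof
    assume "v 1 = 0\<^sub>v ?n'"
    then have "\<forall>z\<in>verts ?G'. f 1 z = 0 \<and> g 1 z = 0"
      unfolding v_def vertex_vec_zero[symmetric] vertex_vec_eq_iff ws(2) by simp
    then have "u 1 = 0\<^sub>v ?n"
      using u[of 1] k vs(2)
      unfolding vertex_vec_zero[symmetric] by (auto simp: vertex_vec_eq_iff glue_def)
    then show False using u1 by simp
  qed
  moreover have "K_mat ?G' ws *\<^sub>v v 1 = \<mu> \<cdot>\<^sub>v v 1"
  proof -
    have "K_mat ?G' ws *\<^sub>v v 1 - \<mu> \<cdot>\<^sub>v v 1 = 0\<^sub>v ?n'"
      using v_step[of 0] k v0 shifted_mult_vec[OF K_mat_carrier[of ?G' ws], of "v 1" \<mu>]
      by (simp add: v_def)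
    then have "(K_mat ?G' ws *\<^sub>v v 1) $ i - (\<mu> \<cdot>\<^sub>v v 1) $ i = 0" if "i < ?n'" for i
      using that by (metis index_minus_vec(1) index_zero_vec(1) index_smult_vec(2) dim_vertex_vec v_def)
    then show ?thesis by (intro eq_vecI) (auto simp: v_def)
  qed
  ultimately have "chain_system (K_mat ?G' ws) \<mu> k v"
    using v0 v_step by (simp add: chain_system_def eigenvector_def v_def)
  then show ?thesis by (rule jordan_chain_exists[OF K_mat_carrier])
qed

end
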